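(* If $G$ is a connected graph of order $n\geq 5$ and $G$ is not isomorphic to the cycle $C_n$, then, as abstract groups, $Aut(G) \cong Aut(L(G)) \cong Aut(S(G))\cong Aut(C(G))\cong Aut(M(G))$.
   Context: All graphs are simple, finite, undirected; $Aut(H)$ is the automorphism group of $H$. $L(G)$ is the line graph. $S(G)$ is the subdivision graph: vertex set $V(G)\cup\{w_{u,v}:\{u,v\}\in E(G)\}$, edges $\{u,w_{u,v}\},\{w_{u,v},v\}$ for each $\{u,v\}\in E(G)$. $C(G)$ is the central graph: same vertex set as $S(G)$, edges those of $S(G)$ together with all pairs of distinct non-adjacent vertices of $G$. $M(G)$ is the middle graph: vertex set $V(G)\cup E(G)$, with $v\in V(G)$ adjacent to $e\in E(G)$ iff $v$ is an endpoint of $e$, and $e,e'\in E(G)$ adjacent iff they share an endpoint; no two elements of $V(G)$ are adjacent. *)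

theory Defs
  imports "HOL-Algebra.Bij"
begin

record 'a graph =
  verts :: "'a set"
  edges :: "'a set set"

definition simple_graph :: "'a graph \<Rightarrow> bool" where
  "simple_graph G \<longleftrightarrow> finite (verts G) \<and>
     edges G \<subseteq> {{u, v} | u v. u \<in> verts G \<and> v \<in> verts G \<and> u \<noteq> v}"

definition connected_graph :: "'a graph \<Rightarrow> bool" where
  "connected_graph G \<longleftrightarrow> verts G \<noteq> {} \<and>
     (\<forall>u \<in> verts G. \<forall>v \<in> verts G. (u, v) \<in> {(x, y). {x, y} \<in> edges G}\<^sup>*)"

definition graph_isomorphism :: "'a graph \<Rightarrow> 'b graph \<Rightarrow> ('a \<Rightarrow> 'b) \<Rightarrow> bool" where
  "graph_isomorphism G H f \<longleftrightarrow> bij_betw f (verts G) (verts H) \<and>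
     (\<forall>u \<in> verts G. \<forall>v \<in> verts G. {u, v} \<in> edges G \<longleftrightarrow> {f u, f v} \<in> edges H)"

definition isomorphic_graphs :: "'a graph \<Rightarrow> 'b graph \<Rightarrow> bool" where
  "isomorphic_graphs G H \<longleftrightarrow> (\<exists>f. graph_isomorphism G H f)"

text \<open>As in \<^const>\<open>BijGroup\<close>, the elements are extensional functions on the vertex set, so that
  two automorphisms which agree on all vertices are equal.\<close>

definition Aut :: "'a graph \<Rightarrow> ('a \<Rightarrow> 'a) monoid" where
  "Aut G = BijGroup (verts G)
     \<lparr>carrier := {f \<in> Bij (verts G). graph_isomorphism G G f}\<rparr>"

text \<open>The cycle on \<open>n\<close> vertices; meaningful for \<open>n \<ge> 3\<close>.\<close>

definition cycle_graph :: "nat \<Rightarrow> nat graph" where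
  "cycle_graph n = \<lparr>verts = {0..<n}, edges = {{i, Suc i mod n} | i. i < n}\<rparr>"

definition line_graph :: "'a graph \<Rightarrow> 'a set graph" where
  "line_graph G =
     \<lparr>verts = edges G,
      edges = {{e, e'} | e e'. e \<in> edges G \<and> e' \<in> edges G \<and> e \<noteq> e' \<and> e \<inter> e' \<noteq> {}}\<rparr>"

text \<open>In the next three constructions, \<open>Inl v\<close> is the original vertex \<open>v\<close>, and \<open>Inr {u, v}\<close> is
  the new vertex coming from the edge \<open>{u, v}\<close>, written \<open>w\<close> with index \<open>u,v\<close> for the subdivision
  and central graphs.\<close>

definition subdivision_graph :: "'a graph \<Rightarrow> ('a + 'a set) graph" where
  "subdivision_graph G =
     \<lparr>verts = Inl ` verts G \<union> Inr ` edges G,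
      edges = {{Inl u, Inr e} | u e. e \<in> edges G \<and> u \<in> e}\<rparr>"

definition central_graph :: "'a graph \<Rightarrow> ('a + 'a set) graph" where
  "central_graph G =
     \<lparr>verts = verts (subdivision_graph G),
      edges = edges (subdivision_graph G) \<union>
        {{Inl u, Inl v} | u v. u \<in> verts G \<and> v \<in> verts G \<and> u \<noteq> v \<and> {u, v} \<notin> edges G}\<rparr>"

definition middle_graph :: "'a graph \<Rightarrow> ('a + 'a set) graph" where
  "middle_graph G =
     \<lparr>verts = Inl ` verts G \<union> Inr ` edges G,
      edges = {{Inl v, Inr e} | v e. v \<in> verts G \<and> e \<in> edges G \<and> v \<in> e} \<union>
        {{Inr e, Inr e'} | e e'. e \<in> edges G \<and> e' \<in> edges G \<and> e \<noteq> e' \<and> e \<inter> e' \<noteq> {}}\<rparr>"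

lemma group_Aut: "group (Aut G)"
proof -
  let ?V = "verts G" and ?A = "{f \<in> Bij (verts G). graph_isomorphism G G f}"
  interpret group "BijGroup ?V" by (rule group_BijGroup)
  have maps: "f x \<in> ?V" if "f \<in> Bij ?V" "x \<in> ?V" for f x
    using that by (auto simp: Bij_def bij_betw_def)
  have "subgroup ?A (BijGroup ?V)"
  proof (rule subgroupI)
    show "?A \<subseteq> carrier (BijGroup ?V)"
      by (auto simp: BijGroup_def)
    have "restrict id ?V \<in> ?A"
      using id_Bij by (auto simp: graph_isomorphism_def bij_betw_def inj_on_def id_def)
    then show "?A \<noteq> {}" by blast
  next
    fix f assume f: "f \<in> ?A"
    then have bij: "f \<in> Bij ?V" and b: "bij_betw f ?V ?V"
      and pres: "\<And>u v. u \<in> ?V \<Longrightarrow> v \<in> ?V \<Longrightarrow> {u, v} \<in> edges G \<longleftrightarrow> {f u, f v} \<in> edges G"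
      by (auto simp: graph_isomorphism_def)
    let ?g = "\<lambda>x \<in> ?V. (inv_into ?V f) x"
    have g: "?g \<in> Bij ?V" by (rule restrict_inv_into_Bij[OF bij])
    have fg: "f (?g x) = x" if "x \<in> ?V" for x
      using that b by (simp add: bij_betw_inv_into_right)
    have "{u, v} \<in> edges G \<longleftrightarrow> {?g u, ?g v} \<in> edges G" if "u \<in> ?V" "v \<in> ?V" for u v
      using pres[OF maps[OF g that(1)] maps[OF g that(2)]] fg that by metis
    then have "?g \<in> ?A"
      using g by (auto simp: graph_isomorphism_def Bij_def)
    then show "inv\<^bsub>BijGroup ?V\<^esub> f \<in> ?A"
      using inv_BijGroup[OF bij] by simp
  next
    fix f g assume f: "f \<in> ?A" and g: "g \<in> ?A"
    then have "compose ?V f g \<in> Bij ?V" by (auto intro: compose_Bij)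
    moreover have "graph_isomorphism G G (compose ?V f g)"
      unfolding graph_isomorphism_def
    proof (intro conjI ballI)
      show "bij_betw (compose ?V f g) ?V ?V" using \<open>compose ?V f g \<in> Bij ?V\<close> by (simp add: Bij_def)
      fix u v assume "u \<in> ?V" "v \<in> ?V"
      then show "{u, v} \<in> edges G \<longleftrightarrow> {compose ?V f g u, compose ?V f g v} \<in> edges G"
        using f g maps[of g] by (simp add: graph_isomorphism_def compose_eq)
    qed
    ultimately show "f \<otimes>\<^bsub>BijGroup ?V\<^esub> g \<in> ?A"
      using f g by (simp add: BijGroup_def)
  qed
  then show ?thesis
    unfolding Aut_def by (rule subgroup_imp_group)
qed

lemma simple_graph_finite_edges:
  assumes "simple_graph G"
  shows "finite (edges G)"
proof (rule finite_subset)
  show "edges G \<subseteq> Pow (verts G)" "finite (Pow (verts G))"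
    using assms by (auto simp: simple_graph_def)
qed

lemma simple_graphI:
  assumes "finite (verts G)"
    and "\<And>e. e \<in> edges G \<Longrightarrow> \<exists>u v. e = {u, v} \<and> u \<in> verts G \<and> v \<in> verts G \<and> u \<noteq> v"
  shows "simple_graph G"
  using assms by (auto simp: simple_graph_def)

lemma simple_graph_incident_vertex:
  assumes "simple_graph G" "e \<in> edges G" "v \<in> e"
  shows "v \<in> verts G"
  using assms by (auto simp: simple_graph_def)

lemma simple_graph_line_graph:
  assumes "simple_graph G"
  shows "simple_graph (line_graph G)"
proof (rule simple_graphI)
  show "finite (verts (line_graph G))"
    using simple_graph_finite_edges[OF assms] by (simp add: line_graph_def)
qed (auto simp: line_graph_def)

lemma simple_graph_subdivision_graph:
  assumes "simple_graph G"
  shows "simple_graph (subdivision_graph G)"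
proof (rule simple_graphI)
  show "finite (verts (subdivision_graph G))"
    using assms simple_graph_finite_edges[OF assms]
    by (simp add: simple_graph_def subdivision_graph_def)
next
  fix e assume "e \<in> edges (subdivision_graph G)"
  then obtain u d where "e = {Inl u, Inr d}" "d \<in> edges G" "u \<in> d"
    by (auto simp: subdivision_graph_def)
  then show "\<exists>x y. e = {x, y} \<and> x \<in> verts (subdivision_graph G)
      \<and> y \<in> verts (subdivision_graph G) \<and> x \<noteq> y"
    using simple_graph_incident_vertex[OF assms]
    by (intro exI[of _ "Inl u"] exI[of _ "Inr d"]) (simp add: subdivision_graph_def)
qed

lemma simple_graph_central_graph:
  assumes "simple_graph G"
  shows "simple_graph (central_graph G)"
proof (rule simple_graphI)
  show "finite (verts (central_graph G))"
    using simple_graph_subdivision_graph[OF assms]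
    by (simp add: simple_graph_def central_graph_def)
next
  fix e assume "e \<in> edges (central_graph G)"
  then consider "e \<in> edges (subdivision_graph G)"
    | u v where "e = {Inl u, Inl v}" "u \<in> verts G" "v \<in> verts G" "u \<noteq> v"
    by (auto simp: central_graph_def)
  then show "\<exists>x y. e = {x, y} \<and> x \<in> verts (central_graph G)
      \<and> y \<in> verts (central_graph G) \<and> x \<noteq> y"
  proof cases
    case 1
    then show ?thesis
      using simple_graph_subdivision_graph[OF assms]
      unfolding simple_graph_def central_graph_def graph.simps by blast
  next
    case 2
    then show ?thesis
      by (intro exI[of _ "Inl u"] exI[of _ "Inl v"])
        (simp add: central_graph_def subdivision_graph_def)
  qed
qed

lemma simple_graph_middle_graph:
  assumes "simple_graph G"
  shows "simple_graph (middle_graph G)"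
proof (rule simple_graphI)
  show "finite (verts (middle_graph G))"
    using assms simple_graph_finite_edges[OF assms]
    by (simp add: simple_graph_def middle_graph_def)
next
  fix e assume "e \<in> edges (middle_graph G)"
  then consider v d where "e = {Inl v, Inr d}" "v \<in> verts G" "d \<in> edges G"
    | d d' where "e = {Inr d, Inr d'}" "d \<in> edges G" "d' \<in> edges G" "d \<noteq> d'"
    by (auto simp: middle_graph_def)
  then show "\<exists>x y. e = {x, y} \<and> x \<in> verts (middle_graph G)
      \<and> y \<in> verts (middle_graph G) \<and> x \<noteq> y"
  proof cases
    case 1
    then show ?thesis
      by (intro exI[of _ "Inl v"] exI[of _ "Inr d"]) (simp add: middle_graph_def)
  next
    case 2
    then show ?thesis
      by (intro exI[of _ "Inr d"] exI[of _ "Inr d'"]) (simp add: middle_graph_def)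
  qed
qed

lemma simple_graph_cycle_graph:
  assumes "n \<ge> 3"
  shows "simple_graph (cycle_graph n)"
proof (rule simple_graphI)
  show "finite (verts (cycle_graph n))"
    by (simp add: cycle_graph_def)
next
  fix e assume "e \<in> edges (cycle_graph n)"
  then obtain i where "e = {i, Suc i mod n}" "i < n"
    by (auto simp: cycle_graph_def)
  moreover have "Suc i mod n < n" "Suc i mod n \<noteq> i"
    using assms \<open>i < n\<close> by (auto simp: mod_Suc)
  ultimately show "\<exists>u v. e = {u, v} \<and> u \<in> verts (cycle_graph n)
      \<and> v \<in> verts (cycle_graph n) \<and> u \<noteq> v"
    by (intro exI[of _ i] exI[of _ "Suc i mod n"]) (simp add: cycle_graph_def)
qed

end

(* In M(G) the neighbourhood of an original vertex is a clique and that of an edge vertex is not; in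
   C(G) edge vertices have degree 2 and original vertices have degree n - 1; S(G) is bipartite, and
   an automorphism exchanging its two sides forces G to be 2-regular, hence a cycle. So automorphisms
   of these graphs preserve the original vertices and are determined there by an automorphism of G.
   For L(G) (Whitney): a triangle meets every other edge in an even number of its edges, whereas
   for n >= 5 every claw has an edge leaving its four vertices, which meets 1 or 3 of its edges. Hence
   automorphisms of L(G) map claws to claws, then stars to stars, which yields the vertex map. *)

theory Submission imports Defs begin

section \<open>Automorphisms as extensional functions\<close>

text \<open>\<open>graph_isomorphism\<close> constrains values on \<open>verts G\<close> alone,
  while carrier elements are extensional; restricting bridges the two.\<close>

lemma AutI: "graph_isomorphism G G f \<Longrightarrow> restrict f (verts G) \<in> carrier (Aut G)"
  by (auto simp: Aut_def Bij_def graph_isomorphism_def)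

lemma Aut_D:
  assumes "f \<in> carrier (Aut G)"
  shows "graph_isomorphism G G f" "f \<in> extensional (verts G)"
  using assms by (auto simp: Aut_def Bij_def)

lemma Aut_mult:
  assumes "f \<in> carrier (Aut G)" "g \<in> carrier (Aut G)"
  shows "f \<otimes>\<^bsub>Aut G\<^esub> g = compose (verts G) f g"
  using assms by (auto simp: Aut_def BijGroup_def)

lemma graph_isomorphism_bij: "graph_isomorphism G H f \<Longrightarrow> bij_betw f (verts G) (verts H)"
  by (simp add: graph_isomorphism_def)

lemma graph_isomorphism_in: "graph_isomorphism G H f \<Longrightarrow> x \<in> verts G \<Longrightarrow> f x \<in> verts H"
  by (auto simp: graph_isomorphism_def bij_betw_def)

lemma graph_isomorphism_eq_iff:
  "graph_isomorphism G H f \<Longrightarrow> x \<in> verts G \<Longrightarrow> y \<in> verts G \<Longrightarrow> f x = f y \<longleftrightarrow> x = y"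
  by (auto simp: graph_isomorphism_def bij_betw_def inj_on_def)

lemma graph_isomorphism_edge_iff:
  "graph_isomorphism G H f \<Longrightarrow> x \<in> verts G \<Longrightarrow> y \<in> verts G
    \<Longrightarrow> {f x, f y} \<in> edges H \<longleftrightarrow> {x, y} \<in> edges G"
  by (simp add: graph_isomorphism_def)

lemma graph_isomorphism_surj:
  assumes "graph_isomorphism G H f" "y \<in> verts H"
  obtains x where "x \<in> verts G" "f x = y"
  using assms by (metis graph_isomorphism_bij bij_betw_imp_surj_on imageE)

lemma graph_isomorphism_inv:
  assumes "graph_isomorphism G H f"
  shows "graph_isomorphism H G (inv_into (verts G) f)"
proof -
  let ?g = "inv_into (verts G) f"
  have b: "bij_betw f (verts G) (verts H)" using assms by (rule graph_isomorphism_bij)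
  have "{u, v} \<in> edges H \<longleftrightarrow> {?g u, ?g v} \<in> edges G" if "u \<in> verts H" "v \<in> verts H" for u v
  proof -
    have "?g u \<in> verts G" "?g v \<in> verts G" "f (?g u) = u" "f (?g v) = v"
      using b that by (auto simp: bij_betw_def inv_into_into f_inv_into_f)
    then show ?thesis using graph_isomorphism_edge_iff[OF assms, of "?g u" "?g v"] by simp
  qed
  then show ?thesis using bij_betw_inv_into[OF b] by (simp add: graph_isomorphism_def)
qed

lemma simple_graph_edgeE:
  assumes "simple_graph G" "e \<in> edges G" "v \<in> e"
  obtains w where "e = {v, w}" "w \<noteq> v" "v \<in> verts G" "w \<in> verts G"
  using assms by (auto simp: simple_graph_def)

lemma simple_graph_edge_ends:
  assumes "simple_graph G" "e \<in> edges G"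
  obtains v w where "e = {v, w}" "w \<noteq> v" "v \<in> verts G" "w \<in> verts G"
  using assms by (auto simp: simple_graph_def)

lemma simple_graph_no_loop: "simple_graph G \<Longrightarrow> {v, v} \<notin> edges G"
  by (auto simp: simple_graph_def)

lemma graph_automorphism_image_edge:
  assumes "simple_graph G" "graph_isomorphism G G f" "e \<in> edges G"
  shows "f ` e \<in> edges G"
proof -
  obtain v w where "e = {v, w}" "v \<in> verts G" "w \<in> verts G"
    using simple_graph_edge_ends assms by metis
  then show ?thesis using graph_isomorphism_edge_iff[OF assms(2), of v w] assms by simp
qed

text \<open>Injectivity on vertices carries over to sets of vertices, and an injective self-map of
  the finite edge set is onto.\<close>

lemma bij_betw_image_edges:
  assumes "simple_graph G" "graph_isomorphism G G f"
  shows "bij_betw ((`) f) (edges G) (edges G)"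
proof -
  have "edges G \<subseteq> Pow (verts G)"
    using assms(1) by (auto simp: simple_graph_def)
  moreover have "inj_on f (verts G)"
    using assms(2) by (auto simp: graph_isomorphism_def bij_betw_def)
  ultimately have "inj_on ((`) f) (edges G)"
    using inj_on_image_Pow inj_on_subset by blast
  moreover have "(`) f ` edges G \<subseteq> edges G"
    using graph_automorphism_image_edge[OF assms] by blast
  ultimately show ?thesis
    using simple_graph_finite_edges[OF assms(1)] by (metis bij_betw_def endo_inj_surj)
qed

section \<open>Group isomorphisms from actions on vertices\<close>

text \<open>Common frame of all four isomorphisms: an action \<open>T\<close> of the automorphisms
  of \<open>G\<close> on the vertices of \<open>H\<close> becomes the homomorphism sending
  \<open>f\<close> to \<open>restrict (T f) (verts H)\<close>. Here \<open>faithful\<close> gives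
  injectivity and \<open>onto\<close> surjectivity; \<open>cong\<close> lets callers work with raw
  functions instead of extensional ones.\<close>

lemma Aut_iso_by_action:
  assumes iso: "\<And>f. graph_isomorphism G G f \<Longrightarrow> graph_isomorphism H H (T f)"
    and comp: "\<And>f g x. graph_isomorphism G G f \<Longrightarrow> graph_isomorphism G G g \<Longrightarrow> x \<in> verts H
      \<Longrightarrow> T (compose (verts G) f g) x = T f (T g x)"
    and faithful: "\<And>f g v. graph_isomorphism G G f \<Longrightarrow> graph_isomorphism G G g
      \<Longrightarrow> (\<And>x. x \<in> verts H \<Longrightarrow> T f x = T g x) \<Longrightarrow> v \<in> verts G \<Longrightarrow> f v = g v"
    and cong: "\<And>f x. x \<in> verts H \<Longrightarrow> T (restrict f (verts G)) x = T f x"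
    and onto: "\<And>h. graph_isomorphism H H h
      \<Longrightarrow> \<exists>f. graph_isomorphism G G f \<and> (\<forall>x \<in> verts H. T f x = h x)"
  shows "Aut G \<cong> Aut H"
proof -
  let ?F = "\<lambda>f. restrict (T f) (verts H)"
  have carr: "?F f \<in> carrier (Aut H)" if "f \<in> carrier (Aut G)" for f
    using AutI iso Aut_D(1) that by blast
  have "?F (f \<otimes>\<^bsub>Aut G\<^esub> g) = ?F f \<otimes>\<^bsub>Aut H\<^esub> ?F g"
    if "f \<in> carrier (Aut G)" "g \<in> carrier (Aut G)" for f g
  proof -
    have "T g x \<in> verts H" if "x \<in> verts H" for x
      using graph_isomorphism_in[OF iso[OF Aut_D(1)] that] \<open>g \<in> carrier (Aut G)\<close> by blast
    then show ?thesis
      using comp[OF Aut_D(1) Aut_D(1)] that carr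
      by (auto simp: Aut_mult compose_def restrict_def fun_eq_iff)
  qed
  moreover have "inj_on ?F (carrier (Aut G))"
  proof (rule inj_onI)
    fix f g assume f: "f \<in> carrier (Aut G)" and g: "g \<in> carrier (Aut G)" and eq: "?F f = ?F g"
    have "T f x = T g x" if "x \<in> verts H" for x
      using fun_cong[OF eq, of x] that by simp
    then have "f v = g v" if "v \<in> verts G" for v
      using faithful Aut_D(1) f g that by blast
    then show "f = g" using Aut_D(2) f g extensionalityI by blast
  qed
  moreover have "h \<in> ?F ` carrier (Aut G)" if h: "h \<in> carrier (Aut H)" for h
  proof -
    obtain f where f: "graph_isomorphism G G f" "\<forall>x \<in> verts H. T f x = h x"
      using onto Aut_D(1)[OF h] by blast
    \<comment> \<open>Only the restriction of \<open>f\<close> lies in the carrier;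
      \<open>cong\<close> keeps its action on \<open>verts H\<close>, and off \<open>verts H\<close>
      both sides are \<open>undefined\<close>.\<close>
    have "?F (restrict f (verts G)) = h"
      using f(2) cong Aut_D(2)[OF h] by (auto simp: restrict_def extensional_def fun_eq_iff)
    then show ?thesis using AutI[OF f(1)] by force
  qed
  ultimately have "?F \<in> iso (Aut G) (Aut H)"
    using carr by (auto simp: iso_def hom_def bij_betw_def)
  then show ?thesis by (auto simp: is_iso_def)
qed

text \<open>Serves the middle, central and subdivision graphs. An automorphism of \<open>G\<close>
  acts on edge vertices by taking images. Conversely, if \<open>h\<close> keeps the original
  vertices among themselves (\<open>pres\<close>), it restricts to a permutation \<open>f\<close> of
  them; an edge vertex is determined by its original neighbours (\<open>incid\<close>), so
  \<open>f\<close> determines \<open>h\<close> there too.\<close>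

lemma Aut_iso_vertex_edge_graph:
  fixes H :: "('a + 'a set) graph"
  assumes G: "simple_graph G"
    and vertsH: "verts H = Inl ` verts G \<union> Inr ` edges G"
    and incid: "\<And>u e. u \<in> verts G \<Longrightarrow> e \<in> edges G \<Longrightarrow> {Inl u, Inr e} \<in> edges H \<longleftrightarrow> u \<in> e"
    and vv: "\<And>f u v. graph_isomorphism G G f \<Longrightarrow> u \<in> verts G \<Longrightarrow> v \<in> verts G
      \<Longrightarrow> {Inl (f u), Inl (f v)} \<in> edges H \<longleftrightarrow> {Inl u, Inl v} \<in> edges H"
    and ee: "\<And>f d e. graph_isomorphism G G f \<Longrightarrow> d \<in> edges G \<Longrightarrow> e \<in> edges G
      \<Longrightarrow> {Inr (f ` d), Inr (f ` e)} \<in> edges H \<longleftrightarrow> {Inr d, Inr e} \<in> edges H"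
    and pres: "\<And>h v. graph_isomorphism H H h \<Longrightarrow> v \<in> verts G \<Longrightarrow> h (Inl v) \<in> range Inl"
  shows "Aut G \<cong> Aut H"
proof -
  let ?T = "\<lambda>f. map_sum f ((`) f)"
  note sub = simple_graph_incident_vertex[OF G]
  show ?thesis
  proof (rule Aut_iso_by_action[where T = ?T])
    fix f assume f: "graph_isomorphism G G f"
    have fV: "bij_betw f (verts G) (verts G)" using f by (rule graph_isomorphism_bij)
    have fE: "bij_betw ((`) f) (edges G) (edges G)" by (rule bij_betw_image_edges[OF G f])
    have "?T f ` Inl ` verts G = Inl ` f ` verts G" "?T f ` Inr ` edges G = Inr ` (`) f ` edges G"
      by (simp_all add: image_image)
    then have "?T f ` verts H = verts H"
      using bij_betw_imp_surj_on[OF fV] bij_betw_imp_surj_on[OF fE] by (simp only: vertsH image_Un)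
    moreover have "inj_on (?T f) (verts H)"
    proof (rule inj_onI)
      fix x y assume xy: "x \<in> verts H" "y \<in> verts H" "?T f x = ?T f y"
      consider u v where "x = Inl u" "y = Inl v" "u \<in> verts G" "v \<in> verts G" "f u = f v"
        | d e where "x = Inr d" "y = Inr e" "d \<in> edges G" "e \<in> edges G" "f ` d = f ` e"
        using xy unfolding vertsH by auto
      then show "x = y"
        using inj_onD[OF bij_betw_imp_inj_on[OF fV]] inj_onD[OF bij_betw_imp_inj_on[OF fE]]
        by metis
    qed
    ultimately have bij: "bij_betw (?T f) (verts H) (verts H)" by (simp add: bij_betw_def)
    have mem: "f u \<in> f ` e \<longleftrightarrow> u \<in> e" if "u \<in> verts G" "e \<in> edges G" for u e
      using that sub graph_isomorphism_eq_iff[OF f] by (metis (no_types, lifting) image_iff)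
    have ve: "{Inl (f u), Inr (f ` e)} \<in> edges H \<longleftrightarrow> {Inl u, Inr e} \<in> edges H"
      if "u \<in> verts G" "e \<in> edges G" for u e
      using that mem incid graph_isomorphism_in[OF f] graph_automorphism_image_edge[OF G f]
      by metis
    \<comment> \<open>The case split on \<open>x\<close> and \<open>y\<close> below meets mixed
      pairs in both orders.\<close>
    have ev: "{Inr (f ` e), Inl (f u)} \<in> edges H \<longleftrightarrow> {Inr e, Inl u} \<in> edges H"
      if "u \<in> verts G" "e \<in> edges G" for u e
      using ve[OF that] by (simp add: insert_commute)
    have "{x, y} \<in> edges H \<longleftrightarrow> {?T f x, ?T f y} \<in> edges H"
      if "x \<in> verts H" "y \<in> verts H" for x y
      using that vv[OF f] ee[OF f] ve ev by (cases x; cases y) (simp_all add: vertsH image_iff)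
    then show "graph_isomorphism H H (?T f)"
      using bij by (simp add: graph_isomorphism_def)
  next
    fix f g x assume "graph_isomorphism G G f" "graph_isomorphism G G g" "x \<in> verts H"
    then show "?T (compose (verts G) f g) x = ?T f (?T g x)"
      using sub by (cases x) (auto simp: vertsH compose_eq image_iff)
  next
    fix f g v
    assume "\<And>x. x \<in> verts H \<Longrightarrow> ?T f x = ?T g x" "v \<in> verts G"
    from this(1)[of "Inl v"] this(2) show "f v = g v" by (simp add: vertsH)
  next
    fix f x assume "x \<in> verts H"
    then show "?T (restrict f (verts G)) x = ?T f x"
      using sub by (cases x) (auto simp: vertsH image_iff)
  next
    fix h assume h: "graph_isomorphism H H h"
    \<comment> \<open>\<open>projl\<close> is only meaningful on left injections, which
      \<open>pres\<close> guarantees for every \<open>v\<close> in \<open>verts G\<close>.\<close>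
    define f where "f = (\<lambda>v. projl (h (Inl v)))"
    have hl: "h (Inl v) = Inl (f v)" if "v \<in> verts G" for v
      using pres[OF h that] by (auto simp: f_def)
    have fV: "f v \<in> verts G" if "v \<in> verts G" for v
      using graph_isomorphism_in[OF h, of "Inl v"] hl[OF that] that by (auto simp: vertsH)
    have finj: "inj_on f (verts G)"
    proof (rule inj_onI)
      fix u v assume uv: "u \<in> verts G" "v \<in> verts G" "f u = f v"
      then show "u = v"
        using graph_isomorphism_eq_iff[OF h, of "Inl u" "Inl v"] hl[of u] hl[of v]
        by (simp add: vertsH)
    qed
    have fbij: "bij_betw f (verts G) (verts G)"
      using endo_inj_surj[OF _ _ finj] fV finj G
      by (simp add: bij_betw_def simple_graph_def image_subset_iff)
    have hr: "h (Inr e) = Inr (f ` e) \<and> f ` e \<in> edges G" if e: "e \<in> edges G" for e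
    proof -
      have he: "h (Inr e) \<in> verts H"
        using graph_isomorphism_in[OF h] e by (auto simp: vertsH)
      \<comment> \<open>Every original vertex is already the image of an original vertex, so
        injectivity of \<open>h\<close> keeps the image of \<open>Inr e\<close> away from
        them.\<close>
      have "h (Inr e) \<noteq> Inl v" for v
      proof
        assume v: "h (Inr e) = Inl v"
        then obtain u where u: "u \<in> verts G" "v = f u"
          using he bij_betw_imp_surj_on[OF fbij] by (auto simp: vertsH)
        then have "h (Inr e) = h (Inl u)" using v hl by simp
        then show False
          using graph_isomorphism_eq_iff[OF h, of "Inr e" "Inl u"] u e by (simp add: vertsH)
      qed
      then obtain d where d: "h (Inr e) = Inr d" "d \<in> edges G" using he by (auto simp: vertsH)
      \<comment> \<open>Comparing the original neighbours of \<open>Inr e\<close> and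
        \<open>Inr d\<close> identifies \<open>d\<close> as the image of \<open>e\<close> under
        \<open>f\<close>.\<close>
      have "f u \<in> d \<longleftrightarrow> u \<in> e" if "u \<in> verts G" for u
        using graph_isomorphism_edge_iff[OF h, of "Inl u" "Inr e"] that e d incid fV hl
        by (simp add: vertsH)
      moreover have "d \<subseteq> f ` verts G" using bij_betw_imp_surj_on[OF fbij] sub d(2) by auto
      ultimately have "d = f ` e" using sub e by blast
      then show ?thesis using d by simp
    qed
    have "{u, v} \<in> edges G \<longleftrightarrow> {f u, f v} \<in> edges G" if uv: "u \<in> verts G" "v \<in> verts G" for u v
    proof
      show "{u, v} \<in> edges G \<Longrightarrow> {f u, f v} \<in> edges G" using hr[of "{u, v}"] by simp
      \<comment> \<open>The preimage of \<open>Inr {f u, f v}\<close> under \<open>h\<close> must be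
        an edge vertex, since original vertices go to original ones; injectivity of \<open>f\<close>
        identifies that edge as \<open>{u, v}\<close>.\<close>
      assume a: "{f u, f v} \<in> edges G"
      then obtain x where x: "x \<in> verts H" "h x = Inr {f u, f v}"
        using graph_isomorphism_surj[OF h, of "Inr {f u, f v}"] by (auto simp: vertsH)
      then obtain e where e: "e \<in> edges G" "x = Inr e" using hl by (auto simp: vertsH)
      then have "f ` e = f ` {u, v}" using x hr by simp
      then have "e = {u, v}"
        using inj_on_image_eq_iff[OF finj, of e "{u, v}"] sub e uv by blast
      then show "{u, v} \<in> edges G" using e by simp
    qed
    then have "graph_isomorphism G G f" using fbij by (simp add: graph_isomorphism_def)
    then show "\<exists>f. graph_isomorphism G G f \<and> (\<forall>x \<in> verts H. ?T f x = h x)"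
      using hl hr by (intro exI[of _ f]) (auto simp: vertsH)
  qed
qed

section \<open>Connectivity\<close>

text \<open>By induction along it, a path starting in \<open>A\<close> never leaves
  \<open>A\<close>. All later path arguments go through this form.\<close>

lemma connected_closed_eq_verts:
  assumes "connected_graph G" "A \<subseteq> verts G" "A \<noteq> {}"
    and "\<And>x y. x \<in> A \<Longrightarrow> {x, y} \<in> edges G \<Longrightarrow> y \<in> A"
  shows "A = verts G"
proof -
  obtain a where a: "a \<in> A" using assms by blast
  have "v \<in> A" if "v \<in> verts G" for v
  proof -
    have "(a, v) \<in> {(x, y). {x, y} \<in> edges G}\<^sup>*"
      using assms a that by (auto simp: connected_graph_def)
    then show ?thesis by (induction rule: rtrancl_induct) (use a assms in auto)
  qed
  then show ?thesis using assms by blast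
qed

section \<open>Middle graph\<close>

text \<open>The work lies in the preservation of original vertices. The ends of \<open>e\<close> are
  two non-adjacent neighbours of \<open>Inr e\<close>, whereas the neighbours of
  \<open>Inl v\<close> are edges through \<open>v\<close>, hence pairwise adjacent.\<close>

lemma Aut_middle_graph:
  assumes G: "simple_graph G"
  shows "Aut G \<cong> Aut (middle_graph G)"
proof (rule Aut_iso_vertex_edge_graph[OF G])
  let ?H = "middle_graph G"
  show "verts ?H = Inl ` verts G \<union> Inr ` edges G" by (simp add: middle_graph_def)
  show ve: "{Inl u, Inr e} \<in> edges ?H \<longleftrightarrow> u \<in> e" if "u \<in> verts G" "e \<in> edges G" for u e
    using that by (auto simp: middle_graph_def doubleton_eq_iff)
  have vv: "{Inl u, Inl v} \<notin> edges ?H" for u v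
    by (auto simp: middle_graph_def doubleton_eq_iff)
  then show "{Inl (f u), Inl (f v)} \<in> edges ?H \<longleftrightarrow> {Inl u, Inl v} \<in> edges ?H" for f u v
    by simp
  have ee: "{Inr d, Inr e} \<in> edges ?H \<longleftrightarrow> d \<noteq> e \<and> d \<inter> e \<noteq> {}"
    if "d \<in> edges G" "e \<in> edges G" for d e
    using that by (auto simp: middle_graph_def doubleton_eq_iff)
  show "{Inr (f ` d), Inr (f ` e)} \<in> edges ?H \<longleftrightarrow> {Inr d, Inr e} \<in> edges ?H"
    if f: "graph_isomorphism G G f" and de: "d \<in> edges G" "e \<in> edges G" for f d e
  proof -
    have inj: "inj_on f (verts G)" and sub: "d \<subseteq> verts G" "e \<subseteq> verts G"
      using f de G by (auto simp: graph_isomorphism_def bij_betw_def simple_graph_def)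
    then show ?thesis
      using ee de graph_automorphism_image_edge[OF G f] inj_on_image_eq_iff[OF inj sub]
      by (simp flip: inj_on_image_Int[OF inj sub])
  qed
  show "h (Inl v) \<in> range Inl" if h: "graph_isomorphism ?H ?H h" and v: "v \<in> verts G" for h v
  proof (rule ccontr)
    assume "h (Inl v) \<notin> range Inl"
    then obtain e where e: "e \<in> edges G" "h (Inl v) = Inr e"
      using graph_isomorphism_in[OF h, of "Inl v"] v by (auto simp: middle_graph_def)
    obtain a b where ab: "e = {a, b}" "b \<noteq> a" "a \<in> verts G" "b \<in> verts G"
      using simple_graph_edge_ends[OF G e(1)] by metis
    \<comment> \<open>Pull an end \<open>c\<close> of \<open>e\<close> back along \<open>h\<close>:
      the preimage is a neighbour of \<open>Inl v\<close>, so it is an edge vertex through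
      \<open>v\<close>.\<close>
    have *: "\<exists>d \<in> edges G. v \<in> d \<and> h (Inr d) = Inl c" if c: "c \<in> verts G" "c \<in> e" for c
    proof -
      obtain x where x: "x \<in> verts ?H" "h x = Inl c"
        using graph_isomorphism_surj[OF h, of "Inl c"] c by (auto simp: middle_graph_def)
      have "{h x, h (Inl v)} \<in> edges ?H" using x e c ve by simp
      then have xv: "{x, Inl v} \<in> edges ?H"
        using graph_isomorphism_edge_iff[OF h x(1), of "Inl v"] v by (simp add: middle_graph_def)
      then obtain d where "d \<in> edges G" "x = Inr d"
        using x(1) vv by (auto simp: middle_graph_def)
      then show ?thesis using xv ve[OF v, of d] x by (auto simp: insert_commute)
    qed
    obtain d1 d2 where d: "d1 \<in> edges G" "v \<in> d1" "h (Inr d1) = Inl a"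
      "d2 \<in> edges G" "v \<in> d2" "h (Inr d2) = Inl b"
      using *[of a] *[of b] ab by auto
    \<comment> \<open>The distinct edges \<open>d1\<close> and \<open>d2\<close> share
      \<open>v\<close>, so they are adjacent, but \<open>h\<close> sends them to the non-adjacent
      \<open>Inl a\<close> and \<open>Inl b\<close>.\<close>
    then have "{Inr d1, Inr d2} \<in> edges ?H" using ee ab by auto
    then show False
      using graph_isomorphism_edge_iff[OF h, of "Inr d1" "Inr d2"] d vv
      by (auto simp: middle_graph_def)
  qed
qed

section \<open>Degrees and the central graph\<close>

text \<open>Yields invariance of degrees. Simplicity puts the neighbourhoods inside the vertex sets,
  where \<open>h\<close> is a bijection.\<close>

lemma graph_isomorphism_nbhd:
  assumes "graph_isomorphism G H h" "simple_graph G" "simple_graph H" "v \<in> verts G"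
  shows "bij_betw h {x. {v, x} \<in> edges G} {y. {h v, y} \<in> edges H}"
proof -
  have G: "{v, x} \<in> edges G \<Longrightarrow> x \<in> verts G" for x
    using simple_graph_incident_vertex[OF assms(2)] by blast
  have H: "{y, z} \<in> edges H \<Longrightarrow> z \<in> verts H" for y z
    using simple_graph_incident_vertex[OF assms(3)] by blast
  have "inj_on h {x. {v, x} \<in> edges G}"
    using graph_isomorphism_eq_iff[OF assms(1)] G by (auto simp: inj_on_def)
  moreover have "h ` {x. {v, x} \<in> edges G} = {y. {h v, y} \<in> edges H}"
  proof (intro Set.set_eqI iffI)
    fix y assume y: "y \<in> {y. {h v, y} \<in> edges H}"
    then obtain x where "x \<in> verts G" "h x = y"
      using graph_isomorphism_surj[OF assms(1), of y] H by auto
    then show "y \<in> h ` {x. {v, x} \<in> edges G}"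
      using y graph_isomorphism_edge_iff[OF assms(1,4), of x] by auto
  qed (use G graph_isomorphism_edge_iff[OF assms(1,4)] in auto)
  ultimately show ?thesis by (simp add: bij_betw_def)
qed

text \<open>Degrees tell the two kinds of vertices apart: an edge vertex has at most two neighbours,
  an original vertex at least \<open>card (verts G) - 1\<close>, which is at least 3.\<close>

lemma Aut_central_graph:
  assumes G: "simple_graph G" and n: "card (verts G) \<ge> 4"
  shows "Aut G \<cong> Aut (central_graph G)"
proof (rule Aut_iso_vertex_edge_graph[OF G])
  let ?H = "central_graph G"
  show vH: "verts ?H = Inl ` verts G \<union> Inr ` edges G"
    by (simp add: central_graph_def subdivision_graph_def)
  show ve: "{Inl u, Inr e} \<in> edges ?H \<longleftrightarrow> u \<in> e" if "u \<in> verts G" "e \<in> edges G" for u e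
    using that by (auto simp: central_graph_def subdivision_graph_def doubleton_eq_iff)
  have vv: "{Inl u, Inl v} \<in> edges ?H \<longleftrightarrow> u \<noteq> v \<and> {u, v} \<notin> edges G"
    if "u \<in> verts G" "v \<in> verts G" for u v
    using that by (auto simp: central_graph_def subdivision_graph_def doubleton_eq_iff insert_commute)
  show "{Inl (f u), Inl (f v)} \<in> edges ?H \<longleftrightarrow> {Inl u, Inl v} \<in> edges ?H"
    if "graph_isomorphism G G f" "u \<in> verts G" "v \<in> verts G" for f u v
    using that vv graph_isomorphism_in[OF that(1)] graph_isomorphism_eq_iff[OF that]
      graph_isomorphism_edge_iff[OF that] by simp
  have "{Inr d, Inr e} \<notin> edges ?H" for d e
    by (auto simp: central_graph_def subdivision_graph_def doubleton_eq_iff)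
  then show "{Inr (f ` d), Inr (f ` e)} \<in> edges ?H \<longleftrightarrow> {Inr d, Inr e} \<in> edges ?H" for f d e
    by simp
  note sH = simple_graph_central_graph[OF G]
  show "h (Inl v) \<in> range Inl" if h: "graph_isomorphism ?H ?H h" and v: "v \<in> verts G" for h v
  proof (rule ccontr)
    assume "h (Inl v) \<notin> range Inl"
    then obtain e where e: "e \<in> edges G" "h (Inl v) = Inr e"
      using graph_isomorphism_in[OF h, of "Inl v"] v by (auto simp: vH)
    obtain a b where ab: "e = {a, b}" "a \<in> verts G" "b \<in> verts G"
      using simple_graph_edge_ends[OF G e(1)] by metis
    let ?N = "{x. {Inl v, x} \<in> edges ?H}"
    have "{x. {Inr e, x} \<in> edges ?H} \<subseteq> {Inl a, Inl b}"
      using ab by (auto simp: central_graph_def subdivision_graph_def doubleton_eq_iff)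
    then have "card {x. {Inr e, x} \<in> edges ?H} \<le> card {Inl a :: 'a + 'a set, Inl b}"
      by (rule card_mono[rotated]) simp
    also have "\<dots> \<le> 2" by (simp add: card_insert_le_m1)
    finally have "card ?N \<le> 2"
      using bij_betw_same_card[OF graph_isomorphism_nbhd[OF h sH sH, of "Inl v"]] v e by (simp add: vH)
    moreover have "card (verts G - {v}) \<le> card ?N"
    proof (rule card_inj_on_le)
      \<comment> \<open>Each \<open>w\<close> other than \<open>v\<close> contributes its own
        neighbour of \<open>Inl v\<close>: the edge vertex of \<open>{v, w}\<close> if this is an
        edge of \<open>G\<close>, and \<open>Inl w\<close> otherwise.\<close>
      let ?m = "\<lambda>w. if {v, w} \<in> edges G then Inr {v, w} else Inl w"
      show "inj_on ?m (verts G - {v})" by (auto simp: inj_on_def doubleton_eq_iff split: if_splits)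
      show "?m ` (verts G - {v}) \<subseteq> ?N" using v vv ve by auto
      have "?N \<subseteq> verts ?H" using simple_graph_incident_vertex[OF sH] by blast
      then show "finite ?N" using sH finite_subset by (auto simp: simple_graph_def)
    qed
    ultimately show False using n v by simp
  qed
qed


section \<open>Connected 2-regular graphs are cycles\<close>

text \<open>Walk through \<open>G\<close> without turning back. With only two neighbours per vertex,
  the first repeated vertex is the start. The visited vertices are closed under adjacency, hence all
  of \<open>verts G\<close>, and the walk \<open>x\<close> is an isomorphism from the cycle.\<close>

lemma two_regular_connected_isomorphic_cycle:
  assumes G: "simple_graph G" "connected_graph G"
    and deg: "\<And>v. v \<in> verts G \<Longrightarrow> card {x. {v, x} \<in> edges G} = 2"
  shows "isomorphic_graphs G (cycle_graph (card (verts G)))"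
proof -
  define N where "N v = {x. {v, x} \<in> edges G}" for v
  have sym: "x \<in> N y \<longleftrightarrow> y \<in> N x" for x y by (simp add: N_def insert_commute)
  have Nverts: "x \<in> verts G" if "x \<in> N y" for x y
    using that simple_graph_incident_vertex[OF G(1)] unfolding N_def by blast
  have loop: "x \<notin> N x" for x using simple_graph_no_loop[OF G(1)] by (auto simp: N_def)
  have ex: "\<exists>c. c \<noteq> a \<and> N b = {a, c}" if "b \<in> N a" for a b
  proof -
    have "card (N b) = 2" using deg[OF Nverts[OF that]] by (simp add: N_def)
    moreover have "a \<in> N b" using that sym by simp
    ultimately have "card (N b) = 2" "a \<in> N b" by simp_all
    then obtain p q where "N b = {p, q}" "p \<noteq> q" by (meson card_2_iff)
    with \<open>a \<in> N b\<close> show ?thesis by auto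
  qed
  obtain v0 where v0: "v0 \<in> verts G" using G(2) by (auto simp: connected_graph_def)
  have "card (N v0) = 2" using deg v0 by (simp add: N_def)
  then obtain v1 where v1: "v1 \<in> N v0" by (metis card_2_iff insertI1)
  \<comment> \<open>A state \<open>(a, b)\<close> is the step being walked; the next one leads from
    \<open>b\<close> to its neighbour other than \<open>a\<close>, which \<open>ex\<close> supplies
    as long as \<open>b\<close> is a neighbour of \<open>a\<close>.\<close>
  define nxt where "nxt = (\<lambda>(a, b). (b, SOME c. c \<noteq> a \<and> N b = {a, c}))"
  define x where "x i = fst ((nxt ^^ i) (v0, v1))" for i
  have snd: "snd ((nxt ^^ i) (v0, v1)) = x (Suc i)" for i
    by (simp add: x_def nxt_def split: prod.split)
  have step: "x (Suc (Suc i)) = (SOME c. c \<noteq> x i \<and> N (x (Suc i)) = {x i, c})" for i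
  proof -
    have "x (Suc (Suc i)) = snd (nxt ((nxt ^^ i) (v0, v1)))" using snd[of "Suc i"] by simp
    also have "\<dots> = snd (nxt (x i, x (Suc i)))"
      using snd[of i] by (metis x_def prod.collapse)
    finally show ?thesis by (simp add: nxt_def)
  qed
  have nb: "x (Suc i) \<in> N (x i)" for i
  proof (induction i)
    case 0
    then show ?case using v1 snd[of 0] by (simp add: x_def nxt_def)
  next
    case (Suc i)
    then show ?case using someI_ex[OF ex[OF Suc]] step[of i] by auto
  qed
  have two: "x (Suc (Suc i)) \<noteq> x i \<and> N (x (Suc i)) = {x i, x (Suc (Suc i))}" for i
    using someI_ex[OF ex[OF nb[of i]]] step[of i] by simp
  have xV: "x i \<in> verts G" for i using Nverts nb sym by blast
  have ne: "x (Suc i) \<noteq> x i" for i using nb[of i] loop by metis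
  have "\<not> inj x"
  proof
    assume "inj x"
    have "finite (range x)"
      using G(1) xV by (intro finite_subset[of "range x" "verts G"]) (auto simp: simple_graph_def)
    then have "finite (UNIV :: nat set)" using \<open>inj x\<close> by (rule finite_imageD)
    then show False by simp
  qed
  then have "\<exists>j. \<exists>i<j. x i = x j" by (metis injI linorder_neqE_nat)
  \<comment> \<open>The first index at which a vertex repeats, so the vertices before it are
    distinct.\<close>
  define j where "j = (LEAST j. \<exists>i<j. x i = x j)"
  obtain i where i: "i < j" "x i = x j"
    using LeastI_ex[OF \<open>\<exists>j. \<exists>i<j. x i = x j\<close>] unfolding j_def by blast
  have inj: "a = b" if "x a = x b" "a < j" "b < j" for a b
    using that not_less_Least[of _ "\<lambda>j. \<exists>i<j. x i = x j", folded j_def]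
    by (metis linorder_neqE_nat)
  obtain m where m: "j = Suc m" using i by (cases j) auto
  \<comment> \<open>If \<open>i\<close> were positive, the predecessor \<open>x m\<close> of the
    repeated vertex would be \<open>x (i - 1)\<close> or \<open>x (i + 1)\<close>. Either case gives
    an earlier repetition, a loop or a step back.\<close>
  have "i = 0"
  proof (rule ccontr)
    assume "i \<noteq> 0"
    then obtain k where k: "i = Suc k" by (cases i) auto
    have "x m \<in> N (x i)" using nb[of m] i m sym by simp
    then have "x m = x k \<or> x m = x (Suc (Suc k))" using two[of k] k by auto
    then show False
    proof
      assume "x m = x k"
      then show False using inj[of m k] i m k by auto
    next
      assume eq: "x m = x (Suc (Suc k))"
      have "Suc (Suc k) \<noteq> j" using ne[of "Suc k"] i k by auto
      then have "m = Suc (Suc k)" using inj[OF eq] i m k by auto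
      then show False using two[of i] i m k by auto
    qed
  qed
  then have x0: "x j = x 0" using i by simp
  \<comment> \<open>Without loops and steps back, the closed walk has length at least 3.\<close>
  have "j \<noteq> 0" "j \<noteq> 1" "j \<noteq> 2" using ne[of 0] two[of 0] i x0 by (auto simp: numeral_2_eq_2)
  then have m2: "m \<ge> 2" using m by auto
  \<comment> \<open>\<open>two\<close> describes positive indices only; the start has the last
    vertex \<open>x m\<close> as its second neighbour.\<close>
  have N0: "N (x 0) = {x 1, x m}"
  proof -
    have "x m \<in> N (x 0)" "x 1 \<in> N (x 0)" using nb[of m] nb[of 0] m x0 sym by auto
    moreover have "x 1 \<noteq> x m" using inj[of 1 m] m m2 by auto
    moreover have "card (N (x 0)) = 2" using deg xV by (simp add: N_def)
    then obtain p q where "N (x 0) = {p, q}" by (meson card_2_iff)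
    ultimately show ?thesis by auto
  qed
  have "x ` {0..<j} = verts G"
  proof (rule connected_closed_eq_verts[OF G(2)])
    show "x ` {0..<j} \<subseteq> verts G" using xV by blast
    show "x ` {0..<j} \<noteq> {}" using m by simp
    fix u w assume "u \<in> x ` {0..<j}" "{u, w} \<in> edges G"
    then obtain a where a: "a < j" "w \<in> N (x a)" by (auto simp: N_def)
    show "w \<in> x ` {0..<j}"
    proof (cases a)
      case 0
      then show ?thesis using a N0 m m2 by auto
    next
      case (Suc k)
      then have "w = x k \<or> w = x (Suc (Suc k))" using a two[of k] by auto
      moreover have "x (Suc (Suc k)) \<in> x ` {0..<j}"
        using a Suc x0 by (cases "Suc (Suc k) = j") auto
      ultimately show ?thesis using a Suc by auto
    qed
  qed
  then have bij: "bij_betw x {0..<j} (verts G)" using inj by (auto simp: bij_betw_def inj_on_def)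
  then have card: "card (verts G) = j" using bij_betw_same_card by fastforce
  \<comment> \<open>Since \<open>x j = x 0\<close>, the reduction modulo \<open>j\<close> in
    \<open>cycle_graph\<close> is invisible to \<open>x\<close>.\<close>
  have wrap: "x (Suc l mod j) = x (Suc l)" if "l < j" for l
    using that x0 by (cases "Suc l = j") auto
  have "{a, b} \<in> edges (cycle_graph j) \<longleftrightarrow> {x a, x b} \<in> edges G" if ab: "a < j" "b < j" for a b
  proof
    assume "{a, b} \<in> edges (cycle_graph j)"
    then obtain l where l: "l < j" "{a, b} = {l, Suc l mod j}" by (auto simp: cycle_graph_def)
    have "{x l, x (Suc l mod j)} \<in> edges G" using nb[of l] wrap[OF l(1)] by (simp add: N_def)
    then show "{x a, x b} \<in> edges G" using arg_cong[OF l(2), of "(`) x"] by simp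
  next
    assume "{x a, x b} \<in> edges G"
    then have b: "x b \<in> N (x a)" by (simp add: N_def)
    have "\<exists>l<j. {a, b} = {l, Suc l mod j}"
    proof (cases a)
      case 0
      then have "b = 1 \<or> b = m" using b N0 inj[of b 1] inj[of b m] ab m m2 by auto
      then show ?thesis
      proof
        assume "b = 1"
        then show ?thesis using 0 m m2 by (intro exI[of _ 0]) auto
      next
        assume "b = m"
        then show ?thesis using 0 m by (intro exI[of _ m]) auto
      qed
    next
      case (Suc k)
      then consider "x b = x k" | "x b = x (Suc (Suc k))" using b two[of k] by auto
      then show ?thesis
      proof cases
        case 1
        then have "b = k" using inj[of b k] ab Suc by simp
        then show ?thesis using ab Suc by (intro exI[of _ k]) auto
      next
        case 2
        then have "x b = x (Suc a mod j)" using wrap[of a] ab Suc by simp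
        then have "b = Suc a mod j" using inj[of b "Suc a mod j"] ab m by simp
        then show ?thesis using ab by (intro exI[of _ a]) auto
      qed
    qed
    then show "{a, b} \<in> edges (cycle_graph j)" by (auto simp: cycle_graph_def)
  qed
  then have "graph_isomorphism (cycle_graph j) G x"
    using bij by (simp add: graph_isomorphism_def) (simp add: cycle_graph_def)
  then show ?thesis
    using graph_isomorphism_inv card by (auto simp: isomorphic_graphs_def)
qed

section \<open>Subdivision graph\<close>

text \<open>If one original vertex changes sides of the bipartition, connectivity makes all of them
  change. Each then has the degree 2 of an edge vertex, so \<open>G\<close> would be a
  cycle.\<close>

lemma Aut_subdivision_graph:
  assumes G: "simple_graph G" and conn: "connected_graph G"
    and not_cycle: "\<not> isomorphic_graphs G (cycle_graph (card (verts G)))"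
  shows "Aut G \<cong> Aut (subdivision_graph G)"
proof (rule Aut_iso_vertex_edge_graph[OF G])
  let ?H = "subdivision_graph G"
  show vH: "verts ?H = Inl ` verts G \<union> Inr ` edges G" by (simp add: subdivision_graph_def)
  show ve: "{Inl u, Inr e} \<in> edges ?H \<longleftrightarrow> u \<in> e" if "u \<in> verts G" "e \<in> edges G" for u e
    using that by (auto simp: subdivision_graph_def doubleton_eq_iff)
  have vv: "{Inl u, Inl v} \<notin> edges ?H" and ee: "{Inr d, Inr e} \<notin> edges ?H" for u v d e
    by (auto simp: subdivision_graph_def doubleton_eq_iff)
  then show "{Inl (f u), Inl (f v)} \<in> edges ?H \<longleftrightarrow> {Inl u, Inl v} \<in> edges ?H"
    and "{Inr (f ` d), Inr (f ` e)} \<in> edges ?H \<longleftrightarrow> {Inr d, Inr e} \<in> edges ?H" for f u v d e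
    by simp_all
  note sH = simple_graph_subdivision_graph[OF G]
  have bip: "x \<in> range Inl \<longleftrightarrow> y \<notin> range Inl" if "{x, y} \<in> edges ?H" for x y
    using that vv ee by (cases x; cases y) auto
  show "h (Inl v) \<in> range Inl" if h: "graph_isomorphism ?H ?H h" and v: "v \<in> verts G" for h v
  proof (rule ccontr)
    assume nv: "h (Inl v) \<notin> range Inl"
    \<comment> \<open>An edge of \<open>G\<close> is a path of length two in the subdivision, so its
      ends stay on a common side under \<open>h\<close>.\<close>
    have swap: "{u \<in> verts G. h (Inl u) \<notin> range Inl} = verts G"
    proof (rule connected_closed_eq_verts[OF conn])
      fix u w assume u: "u \<in> {u \<in> verts G. h (Inl u) \<notin> range Inl}" and e: "{u, w} \<in> edges G"
      have w: "w \<in> verts G" using simple_graph_incident_vertex[OF G e] by simp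
      have "{h (Inl y), h (Inr {u, w})} \<in> edges ?H" if "y \<in> {u, w}" for y
        using graph_isomorphism_edge_iff[OF h, of "Inl y" "Inr {u, w}"] ve[of y "{u, w}"]
          that u w e by (auto simp: vH)
      then show "w \<in> {u \<in> verts G. h (Inl u) \<notin> range Inl}" 
        using u w bip[of "h (Inl u)" "h (Inr {u, w})"] bip[of "h (Inl w)" "h (Inr {u, w})"] by simp
    qed (use v nv in auto)
    have "card {x. {u, x} \<in> edges G} = 2" if u: "u \<in> verts G" for u
    proof -
      obtain e where e: "e \<in> edges G" "h (Inl u) = Inr e"
        using graph_isomorphism_in[OF h, of "Inl u"] swap u by (auto simp: vH)
      obtain a b where ab: "e = {a, b}" "b \<noteq> a" "a \<in> verts G" "b \<in> verts G"
        using simple_graph_edge_ends[OF G e(1)] by metis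
      have "{y. {Inr e, y} \<in> edges ?H} = {Inl a, Inl b}"
        using ab e by (auto simp: subdivision_graph_def doubleton_eq_iff)
      then have "card {y. {Inl u, y} \<in> edges ?H} = 2"
        using bij_betw_same_card[OF graph_isomorphism_nbhd[OF h sH sH, of "Inl u"]] ab e u
        by (simp add: vH)
      \<comment> \<open>The degree of \<open>u\<close> in \<open>G\<close> equals that of
        \<open>Inl u\<close> in the subdivision, as each incident edge has one other end.\<close>
      moreover have "bij_betw (\<lambda>x. Inr {u, x}) {x. {u, x} \<in> edges G} {y. {Inl u, y} \<in> edges ?H}"
      proof (rule bij_betw_imageI)
        show "inj_on (\<lambda>x. Inr {u, x}) {x. {u, x} \<in> edges G}"
          by (auto simp: inj_on_def doubleton_eq_iff)
        have "y \<in> (\<lambda>x. Inr {u, x}) ` {x. {u, x} \<in> edges G}" if y: "{Inl u, y} \<in> edges ?H" for y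
        proof -
          obtain d where d: "y = Inr d" "d \<in> edges G" "u \<in> d"
            using y by (auto simp: subdivision_graph_def doubleton_eq_iff)
          moreover obtain w where "d = {u, w}" using simple_graph_edgeE[OF G d(2,3)] by metis
          ultimately show ?thesis by auto
        qed
        moreover have "{Inl u, Inr {u, x}} \<in> edges ?H" if "{u, x} \<in> edges G" for x
          using ve[OF u that] by simp
        ultimately show "(\<lambda>x. Inr {u, x}) ` {x. {u, x} \<in> edges G} = {y. {Inl u, y} \<in> edges ?H}"
          by blast
      qed
      ultimately show ?thesis using bij_betw_same_card by fastforce
    qed
    then show False
      using two_regular_connected_isomorphic_cycle[OF G conn] not_cycle by blast
  qed
qed

section \<open>Line graph: claws and stars\<close>

text \<open>In the line graph these are the cliques attached to the vertices of \<open>G\<close>;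
  automorphisms of the line graph will be shown to permute them.\<close>

definition star :: "'a graph \<Rightarrow> 'a \<Rightarrow> 'a set set" where
  "star G v = {e \<in> edges G. v \<in> e}"

lemma simple_graph_edges_meet_once:
  assumes "simple_graph G" "d \<in> edges G" "e \<in> edges G" "d \<noteq> e"
    and "v \<in> d" "v \<in> e" "w \<in> d" "w \<in> e"
  shows "v = w"
proof -
  obtain a where "d = {v, a}" using simple_graph_edgeE[OF assms(1,2,5)] by metis
  moreover obtain b where "e = {v, b}" using simple_graph_edgeE[OF assms(1,3,6)] by metis
  ultimately show ?thesis using assms(4,7,8) by auto
qed

text \<open>Excludes an isolated edge, and with \<open>v = w\<close> an isolated vertex.\<close>

lemma connected_two_subset_verts:
  assumes "connected_graph G" "card (verts G) \<ge> 3" "v \<in> verts G" "w \<in> verts G"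
    and "\<And>x y. x \<in> {v, w} \<Longrightarrow> {x, y} \<in> edges G \<Longrightarrow> y \<in> {v, w}"
  shows False
proof -
  have "{v, w} = verts G"
  proof (rule connected_closed_eq_verts[OF assms(1)])
    show "y \<in> {v, w}" if "x \<in> {v, w}" "{x, y} \<in> edges G" for x y
      using assms(5) that .
  qed (use assms(3,4) in auto)
  moreover have "card {v, w} \<le> 2" by (simp add: card_insert_if)
  ultimately show False using assms(2) by simp
qed

text \<open>If distinct vertices had the same star, every edge at one would contain the other, so
  the pair would be closed under adjacency.\<close>

lemma star_inj:
  assumes G: "simple_graph G" "connected_graph G" "card (verts G) \<ge> 3"
    and vw: "v \<in> verts G" "w \<in> verts G" "star G v = star G w"
  shows "v = w"
proof (rule ccontr)
  assume "v \<noteq> w"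
  show False
  proof (rule connected_two_subset_verts[OF G(2,3) vw(1,2)])
    fix x y assume xy: "x \<in> {v, w}" "{x, y} \<in> edges G"
    have "{x, y} \<in> star G v \<longleftrightarrow> {x, y} \<in> star G w" using vw(3) by simp
    then have "v \<in> {x, y} \<longleftrightarrow> w \<in> {x, y}" using xy(2) by (simp add: star_def)
    then show "y \<in> {v, w}" using xy(1) \<open>v \<noteq> w\<close> by auto
  qed
qed

lemma star_graph_automorphism:
  assumes "simple_graph G" and f: "graph_isomorphism G G f" and v: "v \<in> verts G"
  shows "star G (f v) = (`) f ` star G v"
proof -
  have im: "(`) f ` edges G = edges G"
    using bij_betw_image_edges[OF assms(1) f] by (simp add: bij_betw_def)
  have "f v \<in> f ` e \<longleftrightarrow> v \<in> e" if "e \<in> edges G" for e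
    using graph_isomorphism_eq_iff[OF f v] simple_graph_incident_vertex[OF assms(1) that] by auto
  moreover have "star G (f v) = {e \<in> (`) f ` edges G. f v \<in> e}" by (simp add: star_def im)
  ultimately show ?thesis by (auto simp: star_def)
qed

text \<open>Three pairwise meeting edges form a claw or a triangle. The nested equivalence says that
  \<open>d\<close> meets an odd number of them; phrased by meeting alone, it is visible in the line
  graph.\<close>

lemma common_vertex_iff_odd_meeting:
  assumes G: "simple_graph G" "connected_graph G" "card (verts G) \<ge> 5"
    and E: "a \<in> edges G" "b \<in> edges G" "c \<in> edges G" "a \<noteq> b" "a \<noteq> c" "b \<noteq> c"
    and meet: "a \<inter> b \<noteq> {}" "a \<inter> c \<noteq> {}" "b \<inter> c \<noteq> {}"
  shows "a \<inter> b \<inter> c \<noteq> {} \<longleftrightarrow>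
    (\<exists>d \<in> edges G - {a, b, c}. d \<inter> a \<noteq> {} \<longleftrightarrow> (d \<inter> b \<noteq> {} \<longleftrightarrow> d \<inter> c \<noteq> {}))"
    (is "_ \<longleftrightarrow> ?odd")
proof
  assume "a \<inter> b \<inter> c \<noteq> {}"
  then obtain v where v: "v \<in> a" "v \<in> b" "v \<in> c" by blast
  obtain p where p: "a = {v, p}" "p \<noteq> v" "p \<in> verts G" "v \<in> verts G"
    using simple_graph_edgeE[OF G(1) E(1) v(1)] by metis
  obtain q where q: "b = {v, q}" "q \<noteq> v" "q \<in> verts G"
    using simple_graph_edgeE[OF G(1) E(2) v(2)] by metis
  obtain r where r: "c = {v, r}" "r \<noteq> v" "r \<in> verts G"
    using simple_graph_edgeE[OF G(1) E(3) v(3)] by metis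
  \<comment> \<open>The four vertices of the claw. Some edge leaves them: from the centre it meets
    all three edges, from a leaf exactly one.\<close>
  let ?A = "{v, p, q, r}"
  have "card ?A \<le> 4" by (simp add: card_insert_if)
  then have "?A \<noteq> verts G" using G(3) by auto
  then obtain x y where xy: "x \<in> ?A" "{x, y} \<in> edges G" "y \<notin> ?A"
    using connected_closed_eq_verts[OF G(2), of ?A] p q r by blast
  show ?odd
  proof (rule bexI)
    show "{x, y} \<in> edges G - {a, b, c}" using xy p q r by (auto simp: doubleton_eq_iff)
    show "{x, y} \<inter> a \<noteq> {} \<longleftrightarrow> ({x, y} \<inter> b \<noteq> {} \<longleftrightarrow> {x, y} \<inter> c \<noteq> {})"
      using xy p q r E(4-6) by auto
  qed
next
  assume ?odd
  then obtain d where "d \<in> edges G - {a, b, c}"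
    and odd: "d \<inter> a \<noteq> {} \<longleftrightarrow> (d \<inter> b \<noteq> {} \<longleftrightarrow> d \<inter> c \<noteq> {})" by (rule bexE)
  then have d: "d \<in> edges G" "d \<notin> {a, b, c}" by auto
  show "a \<inter> b \<inter> c \<noteq> {}"
  proof
    assume none: "a \<inter> b \<inter> c = {}"
    obtain x where x: "x \<in> a" "x \<in> b" using meet by blast
    obtain y where y: "a = {x, y}" "y \<noteq> x" using simple_graph_edgeE[OF G(1) E(1) x(1)] by metis
    obtain z where z: "b = {x, z}" "z \<noteq> x" using simple_graph_edgeE[OF G(1) E(2) x(2)] by metis
    \<comment> \<open>Without a common vertex, \<open>c\<close> must join the free ends of
      \<open>a\<close> and \<open>b\<close>, closing a triangle.\<close>
    have yz: "y \<in> c" "z \<in> c" "y \<noteq> z" using meet none y z E(4) by auto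
    obtain t where t: "c = {y, t}" using simple_graph_edgeE[OF G(1) E(3) yz(1)] by metis
    then have c: "c = {y, z}" using yz by auto
    obtain s u where su: "d = {s, u}" "u \<noteq> s" using simple_graph_edge_ends[OF G(1) d(1)] by metis
    \<comment> \<open>A fourth edge has at most one end on the triangle, and each corner lies on two
      sides, so it meets none or two of them.\<close>
    have "\<not> {s, u} \<subseteq> {x, y, z}" using su d(2) y z c by (auto simp: doubleton_eq_iff)
    then show False using odd su y z c yz(3) by auto
  qed
qed

lemma line_graph_edge_iff:
  assumes "d \<in> edges G" "e \<in> edges G"
  shows "{d, e} \<in> edges (line_graph G) \<longleftrightarrow> d \<noteq> e \<and> d \<inter> e \<noteq> {}"
proof
  assume "{d, e} \<in> edges (line_graph G)"
  then obtain p q where "{d, e} = {p, q}" "p \<noteq> q" "p \<inter> q \<noteq> {}"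
    unfolding line_graph_def graph.simps by blast
  then show "d \<noteq> e \<and> d \<inter> e \<noteq> {}" by (metis doubleton_eq_iff inf_commute)
next
  assume "d \<noteq> e \<and> d \<inter> e \<noteq> {}"
  then show "{d, e} \<in> edges (line_graph G)"
    unfolding line_graph_def graph.simps using assms by blast
qed

lemma verts_line_graph: "verts (line_graph G) = edges G"
  by (simp add: line_graph_def)

text \<open>Meeting is adjacency in the line graph or equality, the latter because edges are
  nonempty; \<open>h\<close> preserves both.\<close>

lemma line_graph_automorphism_meet_iff:
  assumes "simple_graph G" and h: "graph_isomorphism (line_graph G) (line_graph G) h"
    and de: "d \<in> edges G" "e \<in> edges G"
  shows "h d \<inter> h e \<noteq> {} \<longleftrightarrow> d \<inter> e \<noteq> {}"
proof -
  have V: "d \<in> verts (line_graph G)" "e \<in> verts (line_graph G)" using de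
      by (simp_all add: verts_line_graph)
  have hE: "h d \<in> edges G" "h e \<in> edges G"
    using graph_isomorphism_in[OF h V(1)] graph_isomorphism_in[OF h V(2)]
      by (simp_all add: verts_line_graph)
  show ?thesis
  proof (cases "d = e")
    case True
    moreover have "d \<noteq> {}" "h d \<noteq> {}"
      using simple_graph_edge_ends[OF assms(1)] de hE by (metis insert_not_empty)+
    ultimately show ?thesis by simp
  next
    case False
    then show ?thesis
      using graph_isomorphism_edge_iff[OF h V] graph_isomorphism_eq_iff[OF h V]
        line_graph_edge_iff[OF de] line_graph_edge_iff[OF hE] by simp
  qed
qed

text \<open>The parity criterion speaks only of meeting and distinctness, so \<open>h\<close>
  carries a witness \<open>d\<close> for the claw to a witness \<open>h d\<close> for its
  image.\<close>

lemma line_graph_automorphism_common_vertex: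
  assumes G: "simple_graph G" "connected_graph G" "card (verts G) \<ge> 5"
    and h: "graph_isomorphism (line_graph G) (line_graph G) h"
    and E: "a \<in> edges G" "b \<in> edges G" "c \<in> edges G" "a \<noteq> b" "a \<noteq> c" "b \<noteq> c"
    and common: "a \<inter> b \<inter> c \<noteq> {}"
  shows "h a \<inter> h b \<inter> h c \<noteq> {}"
proof -
  note meet = line_graph_automorphism_meet_iff[OF G(1) h]
  have eq: "h d = h e \<longleftrightarrow> d = e" if "d \<in> edges G" "e \<in> edges G" for d e
    using graph_isomorphism_eq_iff[OF h] that by (simp add: verts_line_graph)
  have hE: "h e \<in> edges G" if "e \<in> edges G" for e
    using graph_isomorphism_in[OF h] that by (simp add: verts_line_graph)
  have m: "a \<inter> b \<noteq> {}" "a \<inter> c \<noteq> {}" "b \<inter> c \<noteq> {}" using common by auto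
  obtain d where "d \<in> edges G - {a, b, c}"
    and odd: "d \<inter> a \<noteq> {} \<longleftrightarrow> (d \<inter> b \<noteq> {} \<longleftrightarrow> d \<inter> c \<noteq> {})"
    using iffD1[OF common_vertex_iff_odd_meeting[OF G E m] common] by (rule bexE)
  then have d: "d \<in> edges G" "d \<notin> {a, b, c}" by auto
  have "h d \<in> edges G - {h a, h b, h c}" using d E eq hE by auto
  moreover have "h d \<inter> h a \<noteq> {} \<longleftrightarrow> (h d \<inter> h b \<noteq> {} \<longleftrightarrow> h d \<inter> h c \<noteq> {})"
    using odd meet[OF d(1)] E(1-3) by simp
  moreover have "h a \<noteq> h b" "h a \<noteq> h c" "h b \<noteq> h c" using E eq by auto
  moreover have "h a \<inter> h b \<noteq> {}" "h a \<inter> h c \<noteq> {}" "h b \<inter> h c \<noteq> {}" using E m meet by auto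
  ultimately show ?thesis
    by (intro iffD2[OF common_vertex_iff_odd_meeting[OF G hE[OF E(1)] hE[OF E(2)] hE[OF E(3)]]] bexI)
qed

text \<open>The images of \<open>d\<close> and \<open>e\<close> share a unique vertex
  \<open>w\<close>. Any third edge of the star forms a claw with \<open>d\<close> and
  \<open>e\<close>, so its image also passes through \<open>w\<close>.\<close>

lemma line_graph_automorphism_star_subset:
  assumes G: "simple_graph G" "connected_graph G" "card (verts G) \<ge> 5"
    and h: "graph_isomorphism (line_graph G) (line_graph G) h"
    and de: "d \<in> star G v" "e \<in> star G v" "d \<noteq> e"
  obtains w where "w \<in> verts G" "h ` star G v \<subseteq> star G w"
proof -
  have E: "d \<in> edges G" "e \<in> edges G" "v \<in> d" "v \<in> e" using de by (auto simp: star_def)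
  have hE: "h e \<in> edges G" if "e \<in> edges G" for e
    using graph_isomorphism_in[OF h] that by (simp add: verts_line_graph)
  have "h d \<inter> h e \<noteq> {}" using line_graph_automorphism_meet_iff[OF G(1) h E(1,2)] E by auto
  then obtain w where w: "w \<in> h d" "w \<in> h e" by blast
  have hne: "h d \<noteq> h e"
    using graph_isomorphism_eq_iff[OF h, of d e] E de(3) by (simp add: verts_line_graph)
  have "w \<in> h c" if c: "c \<in> star G v" for c
  proof (cases "c \<in> {d, e}")
    case False
    then have "h d \<inter> h e \<inter> h c \<noteq> {}"
      using line_graph_automorphism_common_vertex[OF G h E(1,2), of c] c E de(3)
      by (auto simp: star_def)
    then obtain x where x: "x \<in> h d" "x \<in> h e" "x \<in> h c" by blast
    then have "x = w" using simple_graph_edges_meet_once[OF G(1) hE hE hne] E w by blast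
    then show ?thesis using x by simp
  qed (use w in auto)
  then have "h ` star G v \<subseteq> star G w" using hE by (auto simp: star_def)
  moreover have "w \<in> verts G" using simple_graph_incident_vertex[OF G(1) hE[OF E(1)] w(1)] .
  ultimately show ?thesis using that by blast
qed

text \<open>The inclusion is applied to \<open>h\<close> and to its inverse; going forth and back
  must end in the star of \<open>v\<close> itself.\<close>

lemma line_graph_automorphism_big_star:
  assumes G: "simple_graph G" "connected_graph G" "card (verts G) \<ge> 5"
    and h: "graph_isomorphism (line_graph G) (line_graph G) h"
    and de: "d \<in> star G v" "e \<in> star G v" "d \<noteq> e"
  obtains w where "w \<in> verts G" "h ` star G v = star G w"
proof -
  let ?g = "inv_into (edges G) h"
  have g: "graph_isomorphism (line_graph G) (line_graph G) ?g"
    using graph_isomorphism_inv[OF h] by (simp add: verts_line_graph)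
  have bij: "bij_betw h (edges G) (edges G)"
    using graph_isomorphism_bij[OF h] by (simp add: verts_line_graph)
  have gh: "?g (h x) = x" if "x \<in> edges G" for x
    using bij that by (simp add: bij_betw_inv_into_left)
  have hg: "h (?g x) = x" if "x \<in> edges G" for x
    using bij that by (simp add: bij_betw_inv_into_right)
  have E: "d \<in> edges G" "e \<in> edges G" "v \<in> d" "v \<in> e" using de by (auto simp: star_def)
  obtain w where w: "w \<in> verts G" "h ` star G v \<subseteq> star G w"
    using line_graph_automorphism_star_subset[OF G h de] by blast
  have "h d \<noteq> h e" using gh E de(3) by metis
  then obtain u where u: "?g ` star G w \<subseteq> star G u"
    using line_graph_automorphism_star_subset[OF G g, of "h d" w "h e"] w(2) de by blast
  \<comment> \<open>\<open>d\<close> and \<open>e\<close> both return to the star of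
    \<open>u\<close>, but they share only \<open>v\<close>.\<close>
  have "?g (h d) \<in> star G u" "?g (h e) \<in> star G u" using u w(2) de by blast+
  then have "d \<in> star G u" "e \<in> star G u" using gh E by auto
  then have "u = v"
    using simple_graph_edges_meet_once[OF G(1) E(1,2) de(3)] E by (auto simp: star_def)
  have "star G w \<subseteq> h ` star G v"
  proof
    fix x assume x: "x \<in> star G w"
    then have "?g x \<in> star G v" "h (?g x) = x" using u \<open>u = v\<close> hg by (auto simp: star_def)
    then show "x \<in> h ` star G v" by (metis imageI)
  qed
  then show ?thesis using w that by blast
qed

text \<open>Only stars with at least two edges determine their centre, so a leaf needs a separate
  argument: if its edge goes to the edge \<open>{p, q}\<close>, where \<open>p\<close> is the image of its neighbour, then
  \<open>q\<close> must be a leaf as well.\<close>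

lemma line_graph_automorphism_star:
  assumes G: "simple_graph G" "connected_graph G" "card (verts G) \<ge> 5"
    and h: "graph_isomorphism (line_graph G) (line_graph G) h"
    and v: "v \<in> verts G"
  obtains w where "w \<in> verts G" "h ` star G v = star G w"
proof (cases "\<exists>d \<in> star G v. \<exists>e \<in> star G v. d \<noteq> e")
  case True
  then show ?thesis using line_graph_automorphism_big_star[OF G h] that by blast
next
  case False
  let ?g = "inv_into (edges G) h"
  have g: "graph_isomorphism (line_graph G) (line_graph G) ?g"
    using graph_isomorphism_inv[OF h] by (simp add: verts_line_graph)
  have bij: "bij_betw h (edges G) (edges G)"
    using graph_isomorphism_bij[OF h] by (simp add: verts_line_graph)
  have gh: "?g (h x) = x" if "x \<in> edges G" for x
    using bij that by (simp add: bij_betw_inv_into_left)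
  have hg: "h (?g x) = x" if "x \<in> edges G" for x
    using bij that by (simp add: bij_betw_inv_into_right)
  have n3: "card (verts G) \<ge> 3" using G(3) by simp
  \<comment> \<open>A vertex without edges would form a closed set by itself.\<close>
  obtain u where u: "{v, u} \<in> edges G"
    using connected_two_subset_verts[OF G(2) n3 v v] by auto
  let ?e = "{v, u}"
  have uV: "u \<in> verts G" using simple_graph_incident_vertex[OF G(1) u] by simp
  have ev: "?e \<in> star G v" using u by (simp add: star_def)
  have "d = ?e" if "d \<in> star G v" for d using False that ev by metis
  then have sv: "star G v = {?e}" using ev by blast
  \<comment> \<open>Otherwise \<open>?e\<close> would be a component of its own.\<close>
  have "\<exists>d. d \<in> star G u \<and> d \<noteq> ?e"
  proof (rule ccontr)
    assume none: "\<nexists>d. d \<in> star G u \<and> d \<noteq> ?e"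
    show False
    proof (rule connected_two_subset_verts[OF G(2) n3 v uV])
      fix x y assume xy: "x \<in> {v, u}" "{x, y} \<in> edges G"
      then have "{x, y} \<in> star G v \<or> {x, y} \<in> star G u" by (auto simp: star_def)
      then have "{x, y} = ?e" using none sv by (metis singletonD)
      then show "y \<in> {v, u}" by auto
    qed
  qed
  then obtain d where d: "d \<in> star G u" "d \<noteq> ?e" by blast
  have eu: "?e \<in> star G u" using u by (simp add: star_def)
  obtain p where p: "p \<in> verts G" "h ` star G u = star G p"
    using line_graph_automorphism_big_star[OF G h d(1) eu d(2)] by blast
  have "h ?e \<in> star G p" using p eu by blast
  then have he: "h ?e \<in> edges G" "p \<in> h ?e" by (simp_all add: star_def)
  obtain q where q: "h ?e = {p, q}" "q \<noteq> p" "q \<in> verts G"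
    using simple_graph_edgeE[OF G(1) he] by metis
  \<comment> \<open>A second edge \<open>c\<close> at \<open>q\<close> would let the inverse
    \<open>?g\<close> send the star of \<open>q\<close> onto a star containing \<open>?e\<close> and
    another edge. Its centre is then \<open>u\<close>, as \<open>v\<close> is a leaf, so
    \<open>c\<close> lies in \<open>star G p\<close> and shares both \<open>p\<close> and
    \<open>q\<close> with \<open>h ?e\<close>.\<close>
  have "star G q = {h ?e}"
  proof (rule ccontr)
    assume "star G q \<noteq> {h ?e}"
    moreover have heq: "h ?e \<in> star G q" using q he by (simp add: star_def)
    ultimately obtain c where c: "c \<in> star G q" "c \<noteq> h ?e" by blast
    obtain w where w: "?g ` star G q = star G w"
      using line_graph_automorphism_big_star[OF G g c(1) heq c(2)] by blast
    have cE: "c \<in> edges G" using c by (simp add: star_def)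
    have "?e \<in> star G w" using w heq gh[OF u] by (metis imageI)
    moreover have "?g c \<in> star G w" using w c by blast
    moreover have "?g c \<noteq> ?e" using hg[OF cE] c(2) by metis
    ultimately have "w \<noteq> v" "w \<in> ?e" using sv by (metis singletonD, simp add: star_def)
    then have "w = u" by simp
    then have "?g c \<in> star G u" using \<open>?g c \<in> star G w\<close> by simp
    then have "c \<in> star G p" using p hg[OF cE] by (metis imageI)
    then have "p = q"
      using simple_graph_edges_meet_once[OF G(1) cE he(1) c(2), of p q] \<open>c \<in> star G p\<close> c q
      by (simp add: star_def)
    then show False using q by simp
  qed
  then show ?thesis using that[OF q(3)] sv by simp
qed

text \<open>Automorphisms of \<open>G\<close> act on edges by images, faithfully since a star
  determines its centre. Conversely, \<open>h\<close> permutes stars and so induces a vertex map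
  \<open>f\<close>; an edge is the only common member of the stars of its ends, so \<open>f\<close>
  is an automorphism inducing \<open>h\<close>.\<close>

lemma Aut_line_graph:
  assumes G: "simple_graph G" "connected_graph G" "card (verts G) \<ge> 5"
  shows "Aut G \<cong> Aut (line_graph G)"
proof (rule Aut_iso_by_action[where T = "(`)"])
  note sub = simple_graph_incident_vertex[OF G(1)]
  fix f assume f: "graph_isomorphism G G f"
  have inj: "inj_on f (verts G)" using graph_isomorphism_bij[OF f] by (simp add: bij_betw_def)
  have "{d, e} \<in> edges (line_graph G) \<longleftrightarrow> {f ` d, f ` e} \<in> edges (line_graph G)"
    if de: "d \<in> edges G" "e \<in> edges G" for d e
  proof -
    have s: "d \<subseteq> verts G" "e \<subseteq> verts G" using sub de by auto
    have fE: "f ` d \<in> edges G" "f ` e \<in> edges G"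
      using graph_automorphism_image_edge[OF G(1) f] de by auto
    show ?thesis
      using line_graph_edge_iff[OF de] line_graph_edge_iff[OF fE] inj_on_image_eq_iff[OF inj s]
      by (simp flip: inj_on_image_Int[OF inj s])
  qed
  then show "graph_isomorphism (line_graph G) (line_graph G) ((`) f)"
    using bij_betw_image_edges[OF G(1) f] by (simp add: graph_isomorphism_def verts_line_graph)
next
  fix f g e assume "e \<in> verts (line_graph G)"
  then have "e \<subseteq> verts G"
    using simple_graph_incident_vertex[OF G(1)] by (auto simp: verts_line_graph)
  then show "compose (verts G) f g ` e = f ` g ` e"
    by (auto simp: compose_eq image_iff subset_iff)
next
  fix f e assume "e \<in> verts (line_graph G)"
  then have "e \<subseteq> verts G"
    using simple_graph_incident_vertex[OF G(1)] by (auto simp: verts_line_graph)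
  then show "restrict f (verts G) ` e = f ` e" by (auto simp: image_iff subset_iff)
next
  fix f g v
  assume f: "graph_isomorphism G G f" and g: "graph_isomorphism G G g"
    and eq: "\<And>e. e \<in> verts (line_graph G) \<Longrightarrow> f ` e = g ` e" and v: "v \<in> verts G"
  have "(`) f ` star G v = (`) g ` star G v"
    by (intro image_cong refl eq) (simp add: star_def verts_line_graph)
  then have "star G (f v) = star G (g v)"
    using star_graph_automorphism[OF G(1) _ v] f g by simp
  then show "f v = g v"
    using star_inj[OF G(1,2) _ graph_isomorphism_in[OF f v] graph_isomorphism_in[OF g v]] G(3)
    by simp
next
  fix h assume h: "graph_isomorphism (line_graph G) (line_graph G) h"
  have n3: "card (verts G) \<ge> 3" using G(3) by simp
  have inj: "inj_on h (edges G)"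
    using graph_isomorphism_bij[OF h] by (simp add: verts_line_graph bij_betw_def)
  have "\<exists>w. w \<in> verts G \<and> h ` star G v = star G w" if "v \<in> verts G" for v
    using line_graph_automorphism_star[OF G h that] by metis
  then obtain f where fV: "\<And>v. v \<in> verts G \<Longrightarrow> f v \<in> verts G"
    and fs: "\<And>v. v \<in> verts G \<Longrightarrow> h ` star G v = star G (f v)" by metis
  have sE: "star G v \<subseteq> edges G" for v by (auto simp: star_def)
  have finj: "inj_on f (verts G)"
  proof (rule inj_onI)
    fix u v assume uv: "u \<in> verts G" "v \<in> verts G" "f u = f v"
    then have "h ` star G u = h ` star G v" using fs by simp
    then have "star G u = star G v" using inj_on_image_eq_iff[OF inj sE sE] by simp
    then show "u = v" using star_inj[OF G(1,2) n3] uv by blast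
  qed
  have fbij: "bij_betw f (verts G) (verts G)"
    using endo_inj_surj[OF _ _ finj] fV finj G(1)
    by (simp add: bij_betw_def simple_graph_def image_subset_iff)
  \<comment> \<open>Distinct stars share at most the edge joining their centres.\<close>
  have edge: "e = {u, v}" if "e \<in> star G u" "e \<in> star G v" "u \<noteq> v" for e u v
  proof -
    have e: "e \<in> edges G" "u \<in> e" "v \<in> e" using that by (simp_all add: star_def)
    obtain w where "e = {u, w}" using simple_graph_edgeE[OF G(1) e(1,2)] by metis
    then show ?thesis using e(3) that(3) by auto
  qed
  have adj: "{u, v} \<in> edges G \<longleftrightarrow> star G u \<inter> star G v \<noteq> {}" if "u \<noteq> v" for u v
  proof
    show "{u, v} \<in> edges G \<Longrightarrow> star G u \<inter> star G v \<noteq> {}" by (auto simp: star_def)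
    show "star G u \<inter> star G v \<noteq> {} \<Longrightarrow> {u, v} \<in> edges G"
      using edge[of _ u v] that by (auto simp: star_def)
  qed
  have "{u, v} \<in> edges G \<longleftrightarrow> {f u, f v} \<in> edges G" if uv: "u \<in> verts G" "v \<in> verts G" for u v
  proof (cases "u = v")
    case True
    then show ?thesis using simple_graph_no_loop[OF G(1)] by simp
  next
    case False
    then have "f u \<noteq> f v" using finj uv by (auto dest: inj_onD)
    \<comment> \<open>Adjacency of distinct vertices is the meeting of their stars, which the
      injective \<open>h\<close> respects.\<close>
    moreover have "star G (f u) \<inter> star G (f v) = h ` (star G u \<inter> star G v)"
      using fs uv inj_on_image_Int[OF inj sE sE] by simp
    ultimately show ?thesis using adj[OF False] adj[of "f u" "f v"] by simp
  qed
  then have "graph_isomorphism G G f" using fbij by (simp add: graph_isomorphism_def)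
  moreover have "f ` e = h e" if e: "e \<in> edges G" for e
  proof -
    obtain u v where uv: "e = {u, v}" "v \<noteq> u" "u \<in> verts G" "v \<in> verts G"
      using simple_graph_edge_ends[OF G(1) e] by metis
    have "e \<in> star G u" "e \<in> star G v" using uv e by (auto simp: star_def)
    then have "h e \<in> star G (f u)" "h e \<in> star G (f v)" using fs uv by blast+
    moreover have "f u \<noteq> f v" using finj uv by (auto dest: inj_onD)
    ultimately show ?thesis using edge uv by simp
  qed
  ultimately show "\<exists>f. graph_isomorphism G G f \<and> (\<forall>e \<in> verts (line_graph G). f ` e = h e)"
    by (auto simp: verts_line_graph)
qed

theorem theorem2p11:
  fixes G :: "'a graph" and n :: nat
  assumes "simple_graph G"
    and "connected_graph G"
    and "card (verts G) = n"
    and "n \<ge> 5"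
    and "\<not> isomorphic_graphs G (cycle_graph n)"
  shows "Aut G \<cong> Aut (line_graph G)
    \<and> Aut (line_graph G) \<cong> Aut (subdivision_graph G)
    \<and> Aut (subdivision_graph G) \<cong> Aut (central_graph G)
    \<and> Aut (central_graph G) \<cong> Aut (middle_graph G)"
proof -
  have L: "Aut G \<cong> Aut (line_graph G)" using Aut_line_graph assms by blast
  have S: "Aut G \<cong> Aut (subdivision_graph G)" using Aut_subdivision_graph assms by blast
  have C: "Aut G \<cong> Aut (central_graph G)" using Aut_central_graph assms by fastforce
  have M: "Aut G \<cong> Aut (middle_graph G)" using Aut_middle_graph assms by blast
  \<comment> \<open>Neighbours in the chain are compared through \<open>Aut G\<close>; fresh type
    variables let one fact cover graphs with different vertex types.\<close>
  have trans: "X \<cong> Y" if "Aut G \<cong> X" "Aut G \<cong> Y"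
    for X :: "('c \<Rightarrow> 'c) monoid" and Y :: "('d \<Rightarrow> 'd) monoid"
    using group.iso_sym[OF group_Aut that(1)] that(2) iso_trans by blast
  show ?thesis using L S C M by (auto intro: trans)
qed

end
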